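(* Let $N\in\{2,3\}$ and let $f:(0,1)\to\mathbb{R}$ be measurable with $\int_0^1 |f(r)|\,r^{N-1}\,dr<\infty$. The radial equation $$\frac{1}{r^{N-1}}\big[r^{N-1}(\Delta_r u)'\big]'=\frac{N-1}{2}\,\frac{1}{r^{N-1}}\big[r^{N-2}(u')^2\big]'+\lambda f(r),\qquad r\in(0,1),$$ subject to either homogeneous Dirichlet boundary conditions or homogeneous Navier boundary conditions, possesses no weak solutions provided $\lambda\in\mathbb{R}$ is large enough.
   Context: $\Delta_r(\cdot)=\frac{1}{r^{N-1}}[r^{N-1}(\cdot)']'$, and $\mathbb{R}_+=[0,\infty)$. The boundary conditions are $u'(0)=0$, $u(1)=0$, together with $u'(1)=0$ (Dirichlet) or $\Delta_r u(1)=0$ (Navier). For $v:\mathbb{R}_+\to\mathbb{R}$ put $\|v\|_\mu=\left(\int_0^\infty[(v')^2+v^2]e^{(2-N)t}\,dt\right)^{1/2}$. $H^1_\mu$ is the completion with respect to $\|\cdot\|_\mu$ of the smooth functions compactly supported in $(0,\infty)$ (so its elements vanish at $t=0$), and $\tilde H^1_\mu$ is the space of all measurable functions (with weak derivative) of finite norm $\|\cdot\|_\mu$. Weak solutions are understood after the change of variables $w(t)=-u'(e^{-t})$, $t\ge0$: with $g(s)=f(s)s^{N-1}$, a weak solution is a function $w$ satisfying, in the sense of distributions on $(0,\infty)$, $$-w''+(N-2)w'+(N-1)w=\frac{N-1}{2}e^{-t}w^2+\lambda e^{(N-3)t}\int_0^{e^{-t}}g(s)\,ds,$$ with $w\in H^1_\mu$,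 $w(0)=0=\lim_{t\to\infty}w(t)$ in the Dirichlet case, and with $w\in\tilde H^1_\mu$, $w'(0)-(N-1)w(0)=0=\lim_{t\to\infty}w(t)$ in the Navier case. In the Navier case $w'(0)$ makes sense because the remaining terms of the equation are locally integrable on $[0,\infty)$, so $w'$ extends continuously to $t=0$.
   Formalization: The formal theorem also assumes that ∫_0^x f(s)s^{N-1} ds > 0 for some x in (0,1); without it the claim fails (for f = 0, w = 0 is a weak solution for every λ; if these integrals are all ≤ 0, solutions exist for all λ ≥ 0). *)

theory Defs
  imports "HOL-Analysis.Analysis"
begin

text \<open>Throughout, functions on the half-line are total functions on the reals of which only the
  values on \<open>{0<..}\<close> (or \<open>{0..}\<close>, for continuous representatives) are used.\<close>

definition test_function :: "(real \<Rightarrow> real) \<Rightarrow> bool" where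
  "test_function \<phi> \<longleftrightarrow>
     (\<forall>k. (deriv ^^ k) \<phi> differentiable_on UNIV) \<and>
     (\<exists>K. compact K \<and> K \<subseteq> {0<..} \<and> (\<forall>t. t \<notin> K \<longrightarrow> \<phi> t = 0))"

definition loc_integrable :: "(real \<Rightarrow> real) \<Rightarrow> bool" where
  "loc_integrable v \<longleftrightarrow> (\<forall>K. compact K \<longrightarrow> K \<subseteq> {0<..} \<longrightarrow> set_integrable lebesgue K v)"

definition has_weak_deriv :: "(real \<Rightarrow> real) \<Rightarrow> (real \<Rightarrow> real) \<Rightarrow> bool" where
  "has_weak_deriv v v' \<longleftrightarrow> loc_integrable v \<and> loc_integrable v' \<and>
     (\<forall>\<phi>. test_function \<phi> \<longrightarrow>
        (LINT t:{0<..}|lebesgue. v t * deriv \<phi> t) = - (LINT t:{0<..}|lebesgue. v' t * \<phi> t))"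

text \<open>The weak derivative \<open>v'\<close> is passed explicitly, being determined by \<open>v\<close> only almost everywhere.\<close>

definition mu_integrand :: "nat \<Rightarrow> (real \<Rightarrow> real) \<Rightarrow> (real \<Rightarrow> real) \<Rightarrow> real \<Rightarrow> real" where
  "mu_integrand N v v' t = ((v' t)\<^sup>2 + (v t)\<^sup>2) * exp ((2 - real N) * t)"

definition mu_norm :: "nat \<Rightarrow> (real \<Rightarrow> real) \<Rightarrow> (real \<Rightarrow> real) \<Rightarrow> real" where
  "mu_norm N v v' = sqrt (LINT t:{0<..}|lebesgue. mu_integrand N v v' t)"

definition H1_tilde :: "nat \<Rightarrow> (real \<Rightarrow> real) set" where
  "H1_tilde N = {v. \<exists>v'. has_weak_deriv v v' \<and>
     set_integrable lebesgue {0<..} (mu_integrand N v v')}"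

text \<open>The completion of the test functions, realised as their closure inside the complete
  space \<open>H1_tilde N\<close>.\<close>

definition H1_zero :: "nat \<Rightarrow> (real \<Rightarrow> real) set" where
  "H1_zero N = {v. \<exists>v'. has_weak_deriv v v' \<and>
     set_integrable lebesgue {0<..} (mu_integrand N v v') \<and>
     (\<exists>\<phi> :: nat \<Rightarrow> real \<Rightarrow> real. (\<forall>n. test_function (\<phi> n)) \<and>
        (\<lambda>n. mu_norm N (\<lambda>t. \<phi> n t - v t) (\<lambda>t. deriv (\<phi> n) t - v' t)) \<longlonglongrightarrow> 0)}"

definition radial_mass :: "nat \<Rightarrow> (real \<Rightarrow> real) \<Rightarrow> real \<Rightarrow> real" where
  "radial_mass N f x = (LINT s:{0<..<x}|lebesgue. f s * s ^ (N - 1))"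

text \<open>Integrated against a test function, with all derivatives of \<open>w\<close> moved onto it:
  \<open>- w'' + (N - 2) w' + (N - 1) w = (N - 1)/2 e\<^sup>-\<^sup>t w\<^sup>2 + l e\<^bsup>(N - 3) t\<^esup> \<integral>\<^sub>0\<^bsup>exp (- t)\<^esup> f s s\<^bsup>N - 1\<^esup> ds\<close>,
  which is the once integrated radial equation in the variables
  \<open>w t = - u' (exp (- t))\<close>.\<close>

definition distributional_equation ::
    "nat \<Rightarrow> (real \<Rightarrow> real) \<Rightarrow> real \<Rightarrow> (real \<Rightarrow> real) \<Rightarrow> bool" where
  "distributional_equation N f l w \<longleftrightarrow>
     (\<forall>\<phi>. test_function \<phi> \<longrightarrow>
        (LINT t:{0<..}|lebesgue.
           w t * (- deriv (deriv \<phi>) t - (real N - 2) * deriv \<phi> t + (real N - 1) * \<phi> t)) =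
        (LINT t:{0<..}|lebesgue.
           ((real N - 1) / 2 * exp (- t) * (w t)\<^sup>2
             + l * exp ((real N - 3) * t) * radial_mass N f (exp (- t))) * \<phi> t))"

text \<open>Elements of the weighted Sobolev spaces are classes modulo null sets, each with a unique
  representative continuous on \<open>{0..}\<close>. A weak solution is taken to be this
  representative, so that \<open>w 0\<close> and the limit at infinity are meaningful.\<close>

definition dirichlet_weak_solution ::
    "nat \<Rightarrow> (real \<Rightarrow> real) \<Rightarrow> real \<Rightarrow> (real \<Rightarrow> real) \<Rightarrow> bool" where
  "dirichlet_weak_solution N f l w \<longleftrightarrow>
     continuous_on {0..} w \<and> w \<in> H1_zero N \<and> distributional_equation N f l w \<and>
     w 0 = 0 \<and> (w \<longlongrightarrow> 0) at_top"

text \<open>Here \<open>w'\<close> is the weak derivative in its representative extended continuously to \<open>0\<close>.\<close>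

definition navier_weak_solution ::
    "nat \<Rightarrow> (real \<Rightarrow> real) \<Rightarrow> real \<Rightarrow> (real \<Rightarrow> real) \<Rightarrow> bool" where
  "navier_weak_solution N f l w \<longleftrightarrow>
     continuous_on {0..} w \<and> w \<in> H1_tilde N \<and> distributional_equation N f l w \<and>
     (\<exists>w'. has_weak_deriv w w' \<and> continuous_on {0..} w' \<and> w' 0 - (real N - 1) * w 0 = 0) \<and>
     (w \<longlongrightarrow> 0) at_top"

text \<open>Nonexistence for large \<open>l\<close> cannot hold for every integrable \<open>f\<close>: if \<open>f = 0\<close>, then \<open>w = 0\<close> solves
  both problems for every \<open>l\<close>, and if the mass is nowhere positive (for instance \<open>f \<le> 0\<close>), then
  \<open>0\<close> is a supersolution for every \<open>l \<ge> 0\<close>, lying above the solution of the linear problem as a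
  subsolution. The hypothesis that
  \<open>radial_mass N f\<close> is positive somewhere excludes precisely these data; it holds for every
  nonnegative \<open>f\<close> that is not almost everywhere \<open>0\<close>.\<close>

end

theory Submission
  imports Defs "HOL-Computational_Algebra.Polynomial"
begin

text \<open>The obstruction is local, so neither the boundary conditions nor the Sobolev norms play a role.
  Let \<open>l h\<close> be the last term of the equation; \<open>h\<close> is continuous and positive on some interval \<open>[a, b]\<close>.
  Take the test function \<open>\<phi> t = exp (- 1 / (t - a)) exp (- 1 / (b - t))\<close> supported there.
  If \<open>\<L>\<close> is the formal adjoint of the left-hand side, then \<open>(\<L> \<phi>)\<^sup>2 \<le> C \<phi>\<close>, and Young's inequality
  bounds \<open>w \<L> \<phi>\<close> by the nonlinear term \<open>(N - 1) / 2 e\<^sup>-\<^sup>t w\<^sup>2 \<phi>\<close> plus a constant independent of \<open>w\<close>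
  and \<open>l\<close>. Hence \<open>l \<integral> h \<phi>\<close> is bounded.\<close>

section \<open>Flat exponentials and bump functions\<close>

text \<open>The left-hand side divided by \<open>fact n\<close> is a single term of the exponential
  series, whose terms are all nonnegative.\<close>

lemma power_le_fact_exp:
  fixes s :: real
  assumes "0 \<le> s"
  shows "s ^ n \<le> fact n * exp s"
proof -
  have "(\<Sum>i\<in>{n}. s ^ i /\<^sub>R fact i) \<le> (\<Sum>i. s ^ i /\<^sub>R fact i)"
    using assms exp_converges[of s] by (intro sum_le_suminf) (auto simp: sums_iff)
  also have "\<dots> = exp s"
    using exp_converges[of s] by (simp add: sums_iff)
  finally show ?thesis
    by (simp add: field_simps)
qed

text \<open>Used with \<open>s = 1 / t\<close>: the exponential decay absorbs every pole at
  \<open>t = 0\<close>.\<close>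

lemma poly_le_exp:
  fixes p :: "real poly"
  obtains C where "0 \<le> C" "\<And>s. 0 \<le> s \<Longrightarrow> \<bar>poly p s\<bar> \<le> C * exp s"
proof
  let ?C = "\<Sum>i\<le>degree p. \<bar>coeff p i\<bar> * fact i"
  show "0 \<le> ?C"
    by (intro sum_nonneg) auto
  show "\<bar>poly p s\<bar> \<le> ?C * exp s" if "0 \<le> s" for s
  proof -
    have "\<bar>poly p s\<bar> \<le> (\<Sum>i\<le>degree p. \<bar>coeff p i * s ^ i\<bar>)"
      unfolding poly_altdef by (rule sum_abs)
    also have "\<dots> \<le> (\<Sum>i\<le>degree p. \<bar>coeff p i\<bar> * (fact i * exp s))"
      using that by (intro sum_mono) (auto simp: abs_mult intro!: mult_left_mono power_le_fact_exp)
    finally show ?thesis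
      by (simp add: sum_distrib_right mult.assoc)
  qed
qed

text \<open>For \<open>p = 1\<close> this is the classical smooth function that is flat at 0. The
  polynomial in \<open>1 / t\<close> is kept as a parameter because differentiation only changes
  \<open>p\<close>.\<close>

definition flat_exp :: "real poly \<Rightarrow> real \<Rightarrow> real" where
  "flat_exp p t = (if 0 < t then poly p (1 / t) * exp (- (1 / t)) else 0)"

text \<open>With \<open>s = 1 / t\<close> one has \<open>ds/dt = - s^2\<close>, so the chain rule
  turns \<open>p(s) exp(-s)\<close> into \<open>s^2 (p(s) - p'(s)) exp(-s)\<close>.\<close>

definition flat_exp_deriv :: "real poly \<Rightarrow> real poly" where
  "flat_exp_deriv p = monom 1 2 * (p - pderiv p)"

lemma flat_exp_eq_0: "t \<le> 0 \<Longrightarrow> flat_exp p t = 0"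
  by (simp add: flat_exp_def)

lemma flat_exp_smult: "flat_exp (smult c p) t = c * flat_exp p t"
  by (simp add: flat_exp_def)

lemma flat_exp_minus: "flat_exp (- p) t = - flat_exp p t"
  by (simp add: flat_exp_def)

lemma flat_exp_1_nonneg: "0 \<le> flat_exp 1 t"
  by (simp add: flat_exp_def)

lemma flat_exp_1_pos: "0 < t \<Longrightarrow> 0 < flat_exp 1 t"
  by (simp add: flat_exp_def)

text \<open>Quadratic decay forces the derivative at 0 to vanish, which is the only delicate point
  of differentiability. The factor \<open>monom 1 2\<close> in the proof supplies the
  \<open>t^2\<close>.\<close>

lemma flat_exp_le_square:
  obtains C where "0 \<le> C" "\<And>t. \<bar>flat_exp p t\<bar> \<le> C * t\<^sup>2"
proof -
  obtain C where C: "0 \<le> C" "\<And>s. 0 \<le> s \<Longrightarrow> \<bar>poly (monom 1 2 * p) s\<bar> \<le> C * exp s"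
    using poly_le_exp by blast
  have "\<bar>flat_exp p t\<bar> \<le> C * t\<^sup>2" for t
  proof (cases "0 < t")
    case True
    have "\<bar>poly p (1 / t)\<bar> \<le> C * exp (1 / t) * t\<^sup>2"
      using C(2)[of "1 / t"] True by (simp add: poly_monom abs_mult field_simps)
    then have "\<bar>poly p (1 / t)\<bar> * exp (- (1 / t)) \<le> C * exp (1 / t) * t\<^sup>2 * exp (- (1 / t))"
      by (intro mult_right_mono) auto
    also have "\<dots> = C * t\<^sup>2"
      by (simp add: exp_minus)
    finally show ?thesis
      using True by (simp add: flat_exp_def abs_mult)
  qed (use C(1) in \<open>simp add: flat_exp_def\<close>)
  then show ?thesis
    using that C(1) by blast
qed

lemma has_real_derivative_flat_exp:
  "(flat_exp p has_real_derivative flat_exp (flat_exp_deriv p) t) (at t)"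
proof -
  consider "t < 0" | "t = 0" | "0 < t"
    by linarith
  then show ?thesis
  proof cases
    case 1
    have "\<forall>\<^sub>F s in nhds t. flat_exp p s = 0"
      using 1 eventually_nhds_in_open[of "{..<0}" t]
      by (auto simp: flat_exp_eq_0 elim: eventually_mono)
    then show ?thesis
      using 1 by (subst DERIV_cong_ev[OF refl _ refl]) (auto simp: flat_exp_eq_0)
  next
    case 2
    obtain C where C: "\<And>t. \<bar>flat_exp p t\<bar> \<le> C * t\<^sup>2"
      using flat_exp_le_square by blast
    have "((\<lambda>h. flat_exp p h / h) \<longlongrightarrow> 0) (at 0)"
    proof (rule Lim_null_comparison)
      show "\<forall>\<^sub>F h in at 0. norm (flat_exp p h / h) \<le> C * \<bar>h\<bar>"
        using C by (intro eventuallyI) (simp add: divide_simps power2_eq_square mult.assoc flip: abs_mult)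
      show "((\<lambda>h. C * \<bar>h\<bar>) \<longlongrightarrow> 0) (at 0)"
        by (auto intro!: tendsto_eq_intros)
    qed
    then show ?thesis
      using 2 by (simp add: DERIV_def flat_exp_eq_0)
  next
    case 3
    have "((\<lambda>t. poly p (1 / t) * exp (- (1 / t))) has_real_derivative
        poly (flat_exp_deriv p) (1 / t) * exp (- (1 / t))) (at t)"
      using 3 by (auto intro!: derivative_eq_intros DERIV_chain'[OF _ poly_DERIV]
          simp: flat_exp_deriv_def poly_monom field_simps power2_eq_square)
    moreover have "\<forall>\<^sub>F s in nhds t. flat_exp p s = poly p (1 / s) * exp (- (1 / s))"
      using 3 eventually_nhds_in_open[of "{0<..}" t]
      by (auto simp: flat_exp_def elim: eventually_mono)
    ultimately show ?thesis
      using 3 by (subst DERIV_cong_ev[OF refl _ refl]) (auto simp: flat_exp_def)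
  qed
qed

text \<open>Squaring yields two factors \<open>exp (- (1 / t))\<close>: one absorbs the polynomial
  \<open>p * p\<close>, the other remains as \<open>flat_exp 1\<close>.\<close>

lemma flat_exp_square_le:
  obtains C where "0 \<le> C" "\<And>t. (flat_exp p t)\<^sup>2 \<le> C * flat_exp 1 t"
proof -
  obtain C where C: "0 \<le> C" "\<And>s. 0 \<le> s \<Longrightarrow> \<bar>poly (p * p) s\<bar> \<le> C * exp s"
    using poly_le_exp by blast
  have "(flat_exp p t)\<^sup>2 \<le> C * flat_exp 1 t" for t
  proof (cases "0 < t")
    case True
    have "poly (p * p) (1 / t) * exp (- (1 / t)) * exp (- (1 / t))
        \<le> (C * exp (1 / t)) * exp (- (1 / t)) * exp (- (1 / t))"
      using C(2)[of "1 / t"] True by (intro mult_right_mono) auto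
    then show ?thesis
      using True by (simp add: flat_exp_def power2_eq_square exp_minus field_simps)
  qed (simp add: flat_exp_def)
  then show ?thesis
    using that C(1) by blast
qed

section \<open>Bump functions on an interval and their derivatives\<close>

definition bump :: "real \<Rightarrow> real \<Rightarrow> real \<Rightarrow> real" where
  "bump a b t = flat_exp 1 (t - a) * flat_exp 1 (b - t)"

text \<open>A linear space containing \<open>bump a b\<close> and closed under differentiation.\<close>

inductive_set bump_span :: "real \<Rightarrow> real \<Rightarrow> (real \<Rightarrow> real) set" for a b where
  prod: "(\<lambda>t. flat_exp p (t - a) * flat_exp q (b - t)) \<in> bump_span a b"
| add: "\<lbrakk>g \<in> bump_span a b; h \<in> bump_span a b\<rbrakk> \<Longrightarrow> (\<lambda>t. g t + h t) \<in> bump_span a b"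

lemma bump_in_span: "bump a b \<in> bump_span a b"
  unfolding bump_def by (rule bump_span.prod)

lemma bump_nonneg: "0 \<le> bump a b t"
  by (simp add: bump_def flat_exp_1_nonneg)

lemma bump_pos: "t \<in> {a<..<b} \<Longrightarrow> 0 < bump a b t"
  by (simp add: bump_def flat_exp_1_pos)

lemma bump_span_cmult:
  assumes "g \<in> bump_span a b"
  shows "(\<lambda>t. c * g t) \<in> bump_span a b"
  using assms
proof induction
  case (prod p q)
  show ?case
    using bump_span.prod[of "smult c p" a q b] by (simp add: flat_exp_smult mult.assoc)
next
  case (add g h)
  then show ?case
    using bump_span.add[of "\<lambda>t. c * g t" a b "\<lambda>t. c * h t"] by (simp add: distrib_left)
qed

lemma bump_span_eq_0:
  assumes "g \<in> bump_span a b" "t \<notin> {a..b}"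
  shows "g t = 0"
  using assms by induction (auto simp: flat_exp_eq_0)

lemma bump_span_has_derivative:
  assumes "g \<in> bump_span a b"
  shows "\<exists>g'\<in>bump_span a b. \<forall>t. (g has_real_derivative g' t) (at t)"
  using assms
proof induction
  case (prod p q)
  \<comment> \<open>The sign from differentiating \<open>b - t\<close> goes into the polynomial, so
    that both summands are again generators of the span.\<close>
  let ?g' = "\<lambda>t. flat_exp (flat_exp_deriv p) (t - a) * flat_exp q (b - t)
    + flat_exp p (t - a) * flat_exp (- flat_exp_deriv q) (b - t)"
  have "((\<lambda>t. flat_exp p (t - a) * flat_exp q (b - t)) has_real_derivative ?g' t) (at t)" for t
    by (auto intro!: derivative_eq_intros DERIV_chain'[OF _ has_real_derivative_flat_exp]
        simp: flat_exp_minus)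
  moreover have "?g' \<in> bump_span a b"
    by (intro bump_span.intros)
  ultimately show ?case
    by (intro bexI[of _ ?g'] allI)
next
  case (add g h)
  then obtain g' h' where "g' \<in> bump_span a b" "h' \<in> bump_span a b"
    "\<And>t. (g has_real_derivative g' t) (at t)" "\<And>t. (h has_real_derivative h' t) (at t)"
    by blast
  then show ?case
    by (intro bexI[of _ "\<lambda>t. g' t + h' t"] bump_span.add) (auto intro!: DERIV_add)
qed

lemma bump_span_differentiable:
  assumes "g \<in> bump_span a b"
  shows "g differentiable_on UNIV"
  using bump_span_has_derivative[OF assms]
  by (auto simp: differentiable_on_def real_differentiable_def)

lemma bump_span_continuous: "g \<in> bump_span a b \<Longrightarrow> continuous_on S g"
  by (meson bump_span_differentiable continuous_on_subset differentiable_imp_continuous_on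
      top_greatest)

lemma bump_span_deriv:
  assumes "g \<in> bump_span a b"
  shows "deriv g \<in> bump_span a b"
proof -
  obtain g' where "g' \<in> bump_span a b" "\<And>t. (g has_real_derivative g' t) (at t)"
    using bump_span_has_derivative[OF assms] by blast
  moreover from this have "deriv g = g'"
    by (auto intro: DERIV_imp_deriv)
  ultimately show ?thesis
    by simp
qed

lemma bump_span_test_function:
  assumes "g \<in> bump_span a b" "0 < a"
  shows "test_function g"
proof -
  have "(deriv ^^ k) g \<in> bump_span a b" for k
    using assms(1) by (induction k) (auto intro: bump_span_deriv)
  moreover have "compact {a..b}" "{a..b} \<subseteq> {0<..}"
    using assms(2) by auto
  ultimately show ?thesis
    unfolding test_function_def
    using bump_span_differentiable bump_span_eq_0[OF assms(1)] by blast
qed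

text \<open>This yields the estimate for the adjoint operator applied to the bump. Generators
  satisfy it factor by factor; sums follow from
  \<open>(x + y)^2 \<le> 2 x^2 + 2 y^2\<close>.\<close>

lemma bump_span_square_le:
  assumes "g \<in> bump_span a b"
  shows "\<exists>C\<ge>0. \<forall>t. (g t)\<^sup>2 \<le> C * bump a b t"
  using assms
proof induction
  case (prod p q)
  obtain C where C: "0 \<le> C" "\<And>t. (flat_exp p t)\<^sup>2 \<le> C * flat_exp 1 t"
    using flat_exp_square_le by blast
  obtain D where D: "0 \<le> D" "\<And>t. (flat_exp q t)\<^sup>2 \<le> D * flat_exp 1 t"
    using flat_exp_square_le by blast
  have "(flat_exp p (t - a) * flat_exp q (b - t))\<^sup>2 \<le> C * D * bump a b t" for t
    using mult_mono[OF C(2)[of "t - a"] D(2)[of "b - t"]] C(1)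
    by (simp add: bump_def flat_exp_1_nonneg power_mult_distrib mult_ac)
  then show ?case
    using C(1) D(1) by (intro exI[of _ "C * D"]) simp
next
  case (add g h)
  then obtain C D where "0 \<le> C" "\<And>t. (g t)\<^sup>2 \<le> C * bump a b t"
    "0 \<le> D" "\<And>t. (h t)\<^sup>2 \<le> D * bump a b t"
    by blast
  moreover have "(g t + h t)\<^sup>2 \<le> 2 * (g t)\<^sup>2 + 2 * (h t)\<^sup>2" for t
    using zero_le_power2[of "g t - h t"] by (simp add: power2_eq_square algebra_simps)
  ultimately have "(g t + h t)\<^sup>2 \<le> (2 * C + 2 * D) * bump a b t" for t
    by (smt (verit) distrib_right mult.assoc)
  then show ?case
    using \<open>0 \<le> C\<close> \<open>0 \<le> D\<close> by (intro exI[of _ "2 * C + 2 * D"]) simp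
qed

section \<open>The local obstruction\<close>

lemma set_integral_compact_support:
  fixes k :: "real \<Rightarrow> real"
  assumes "continuous_on {a..b} k" "0 < a" "\<And>t. t \<notin> {a..b} \<Longrightarrow> k t = 0"
  shows "(LINT t:{0<..}|lebesgue. k t) = integral {a..b} k"
proof -
  have "(LINT t:{0<..}|lebesgue. k t) = (LINT t:{a..b}|lebesgue. k t)"
    unfolding set_lebesgue_integral_def
    using assms(2,3) by (intro Bochner_Integration.integral_cong) (auto simp: indicator_def)
  also have "\<dots> = integral {a..b} k"
    using assms(1) by (intro set_lebesgue_integral_eq_integral absolutely_integrable_continuous_real)
  finally show ?thesis .
qed

text \<open>Young's inequality after \<open>\<bar>g\<bar> \<le> sqrt C * sqrt y\<close>; the proof
  expands the square of \<open>2 * c * \<bar>w\<bar> * sqrt y - sqrt C\<close>. Avoiding division by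
  \<open>y\<close> covers the zeros of the bump.\<close>

lemma young_bound:
  fixes w g c C y :: real
  assumes "g\<^sup>2 \<le> C * y" "0 \<le> y" "0 \<le> C" "0 < c"
  shows "w * g \<le> c * w\<^sup>2 * y + C / (4 * c)"
proof -
  have "\<bar>g\<bar> \<le> sqrt C * sqrt y"
    using real_le_rsqrt[of "\<bar>g\<bar>" "C * y"] assms by (simp add: real_sqrt_mult)
  then have "\<bar>w\<bar> * \<bar>g\<bar> \<le> \<bar>w\<bar> * (sqrt C * sqrt y)"
    by (intro mult_left_mono) auto
  also have "\<dots> \<le> c * w\<^sup>2 * y + C / (4 * c)"
  proof -
    have "0 \<le> (2 * c * (\<bar>w\<bar> * sqrt y) - sqrt C)\<^sup>2"
      by simp
    also have "\<dots> = 4 * c * (c * w\<^sup>2 * y + C / (4 * c) - \<bar>w\<bar> * (sqrt C * sqrt y))"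
    proof -
      have "4 * c * (C / (4 * c)) = C"
        using assms(4) by simp
      then show ?thesis
        using assms(2,3) by (simp add: power2_diff power_mult_distrib right_diff_distrib distrib_left)
          (simp add: power2_eq_square)
    qed
    finally show ?thesis
      using assms(4) by (simp add: zero_le_mult_iff)
  qed
  finally show ?thesis
    using abs_ge_self[of "w * g"] by (simp add: abs_mult)
qed

text \<open>Measurability of \<open>f\<close> upgrades integrability of the absolute value to that
  of \<open>f s * s ^ (N - 1)\<close> itself; an indefinite integral is continuous.\<close>

lemma continuous_on_radial_mass:
  assumes "f \<in> borel_measurable (lebesgue_on {0<..<1})"
    and "set_integrable lebesgue {0<..<1} (\<lambda>r. \<bar>f r\<bar> * r ^ (N - 1))"
  shows "continuous_on {0..1} (radial_mass N f)"
proof -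
  let ?F = "\<lambda>s. f s * s ^ (N - 1)"
  have "(\<lambda>s. s ^ (N - 1)) \<in> borel_measurable (lebesgue_on {0<..<1::real})"
    by (intro continuous_imp_measurable_on_sets_lebesgue continuous_intros) auto
  then have "?F \<in> borel_measurable (lebesgue_on {0<..<1})"
    using assms(1) by simp
  then have "set_borel_measurable lebesgue {0<..<1} ?F"
    by (simp add: set_borel_measurable_def borel_measurable_restrict_space_iff)
  moreover have "set_integrable lebesgue {0<..<1} (\<lambda>s. \<bar>?F s\<bar>)"
    using assms(2) by (rule set_integrable_cong[THEN iffD1, rotated -1]) (auto simp: abs_mult)
  ultimately have F: "set_integrable lebesgue {0<..<1} ?F"
    by (simp add: set_integrable_abs_iff)
  then have "?F integrable_on {0<..<1}"
    by (rule set_lebesgue_integral_eq_integral)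
  then have "continuous_on {0..1} (\<lambda>x. integral {0..x} ?F)"
    by (intro indefinite_integral_continuous_1) (simp add: integrable_on_open_interval_real)
  moreover have "integral {0..x} ?F = radial_mass N f x" if "x \<in> {0..1}" for x
  proof -
    have "set_integrable lebesgue {0<..<x} ?F"
      by (rule set_integrable_subset[OF F]) (use that in auto)
    then show ?thesis
      unfolding radial_mass_def
      by (simp add: set_lebesgue_integral_eq_integral(2) integral_open_interval_real)
  qed
  ultimately show ?thesis
    by (rule continuous_on_eq)
qed

text \<open>Continuity and the distributional equation are common to both boundary value problems,
  so one threshold serves both.\<close>

lemma no_local_solution:
  fixes N :: nat and f :: "real \<Rightarrow> real"
  assumes "2 \<le> N" "0 < a" "a < b"
    and cont: "continuous_on {a..b} (\<lambda>t. radial_mass N f (exp (- t)))"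
    and pos: "\<And>t. t \<in> {a..b} \<Longrightarrow> 0 < radial_mass N f (exp (- t))"
  shows "\<exists>L. \<forall>l\<ge>L. \<nexists>w. continuous_on {0..} w \<and> distributional_equation N f l w"
proof -
  let ?\<phi> = "bump a b"
  define g where
    "g t = - deriv (deriv ?\<phi>) t - (real N - 2) * deriv ?\<phi> t + (real N - 1) * ?\<phi> t" for t
  define h where "h t = exp ((real N - 3) * t) * radial_mass N f (exp (- t))" for t
  \<comment> \<open>The minimum over \<open>{a..b}\<close> of the coefficient of the quadratic
    term.\<close>
  define c where "c = (real N - 1) / 2 * exp (- b)"
  \<comment> \<open>Subtractions are rewritten as sums of scalar multiples to match the closure
    rules of \<open>bump_span\<close>.\<close>
  have "(\<lambda>t. ((-1) * deriv (deriv ?\<phi>) t + (- (real N - 2)) * deriv ?\<phi> t) + (real N - 1) * ?\<phi> t)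
      \<in> bump_span a b"
    by (intro bump_span.add bump_span_cmult bump_span_deriv bump_in_span)
  then have g: "g \<in> bump_span a b"
    by (simp add: g_def[abs_def] algebra_simps)
  obtain C where C: "0 \<le> C" "\<And>t. (g t)\<^sup>2 \<le> C * ?\<phi> t"
    using bump_span_square_le[OF g] by blast
  have "0 < c"
    using assms(1) by (simp add: c_def)
  have cont_\<phi>: "continuous_on {a..b} ?\<phi>"
    by (rule bump_span_continuous[OF bump_in_span])
  have cont_g: "continuous_on {a..b} g"
    by (rule bump_span_continuous[OF g])
  have cont_h: "continuous_on {a..b} h"
    unfolding h_def by (intro continuous_intros cont)
  define I where "I = integral {a..b} (\<lambda>t. h t * ?\<phi> t)"
  \<comment> \<open>The bump vanishes at the endpoints, so strict positivity of the integrand is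
    available on the open interval only.\<close>
  have "integral {a..b} (\<lambda>_. 0) < I"
    unfolding I_def using assms(3) pos cont_h cont_\<phi>
    by (intro integral_less_real continuous_intros) (auto simp: h_def bump_pos)
  then have "0 < I"
    by simp
  \<comment> \<open>The Young constant integrated over \<open>{a..b}\<close>; it depends on neither
    \<open>w\<close> nor \<open>l\<close>.\<close>
  define K where "K = C / (4 * c) * (b - a)"
  have "l * I \<le> K" if w: "continuous_on {0..} w" and eq: "distributional_equation N f l w" for l w
  proof -
    have cont_w: "continuous_on {a..b} w"
      using w by (rule continuous_on_subset) (use assms(2) in auto)
    let ?S = "\<lambda>t. (real N - 1) / 2 * exp (- t) * (w t)\<^sup>2"
    have S: "continuous_on {a..b} ?S"
      by (intro continuous_intros cont_w)
    have "(LINT t:{0<..}|lebesgue. w t * g t) = (LINT t:{0<..}|lebesgue. (?S t + l * h t) * ?\<phi> t)"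
      using eq bump_span_test_function[OF bump_in_span assms(2)]
      unfolding distributional_equation_def g_def h_def by (simp add: mult.assoc)
    moreover have "(LINT t:{0<..}|lebesgue. w t * g t) = integral {a..b} (\<lambda>t. w t * g t)"
      using assms(2) bump_span_eq_0[OF g]
      by (intro set_integral_compact_support continuous_intros cont_w cont_g) auto
    moreover have "(LINT t:{0<..}|lebesgue. (?S t + l * h t) * ?\<phi> t)
        = integral {a..b} (\<lambda>t. (?S t + l * h t) * ?\<phi> t)"
      using assms(2) bump_span_eq_0[OF bump_in_span]
      by (intro set_integral_compact_support continuous_intros S cont_h cont_\<phi>) auto
    ultimately have "integral {a..b} (\<lambda>t. (?S t + l * h t) * ?\<phi> t)
        = integral {a..b} (\<lambda>t. w t * g t)"
      by simp
    also have "\<dots> \<le> integral {a..b} (\<lambda>t. ?S t * ?\<phi> t + C / (4 * c))"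
    proof (intro integral_le integrable_continuous_interval continuous_intros cont_w cont_g cont_\<phi>)
      fix t assume t: "t \<in> {a..b}"
      have "w t * g t \<le> c * (w t)\<^sup>2 * ?\<phi> t + C / (4 * c)"
        using C bump_nonneg \<open>0 < c\<close> by (intro young_bound) auto
      moreover have "c * ((w t)\<^sup>2 * ?\<phi> t) \<le> (real N - 1) / 2 * exp (- t) * ((w t)\<^sup>2 * ?\<phi> t)"
        using t assms(1) by (intro mult_right_mono) (auto simp: c_def bump_nonneg)
      ultimately show "w t * g t \<le> ?S t * ?\<phi> t + C / (4 * c)"
        by (simp add: mult.assoc)
    qed
    also have "\<dots> = integral {a..b} (\<lambda>t. ?S t * ?\<phi> t) + K"
      using assms(3) unfolding K_def
      by (subst integral_add) (auto intro!: integrable_continuous_interval continuous_intros cont_w cont_\<phi>)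
    \<comment> \<open>Splitting the left-hand side below makes the quadratic integral appear on both
      sides; it cancels and leaves \<open>l * I \<le> K\<close>.\<close>
    finally have "integral {a..b} (\<lambda>t. (?S t + l * h t) * ?\<phi> t)
        \<le> integral {a..b} (\<lambda>t. ?S t * ?\<phi> t) + K" .
    moreover have "integral {a..b} (\<lambda>t. (?S t + l * h t) * ?\<phi> t)
        = integral {a..b} (\<lambda>t. ?S t * ?\<phi> t + l * (h t * ?\<phi> t))"
      by (simp add: algebra_simps)
    moreover have "\<dots> = integral {a..b} (\<lambda>t. ?S t * ?\<phi> t) + l * I"
      unfolding I_def
      by (subst integral_add)
        (auto intro!: integrable_continuous_interval continuous_intros cont_w cont_\<phi> cont_h)
    ultimately show ?thesis
      by simp
  qed
  moreover have "K < l * I" if "K / I + 1 \<le> l" for l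
  proof -
    have "K / I < l"
      using that by simp
    then show ?thesis
      using \<open>0 < I\<close> by (simp add: pos_divide_less_eq)
  qed
  ultimately show ?thesis
    by (meson not_le)
qed

theorem theorem2p5:
  fixes N :: nat and f :: "real \<Rightarrow> real"
  assumes "N \<in> {2, 3}"
    and "f \<in> borel_measurable (lebesgue_on {0<..<1})"
    and "set_integrable lebesgue {0<..<1} (\<lambda>r. \<bar>f r\<bar> * r ^ (N - 1))"
    and "\<exists>x\<in>{0<..<1}. radial_mass N f x > 0"
  shows "\<exists>L::real. \<forall>l\<ge>L.
    \<not> (\<exists>w. dirichlet_weak_solution N f l w) \<and> \<not> (\<exists>w. navier_weak_solution N f l w)"
proof -
  let ?m = "\<lambda>t. radial_mass N f (exp (- t))"
  have cont: "continuous_on {0<..} ?m"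
  proof (rule continuous_on_compose2[OF continuous_on_radial_mass[OF assms(2,3)]])
    show "continuous_on {0<..} (\<lambda>t. exp (- t) :: real)"
      by (intro continuous_intros)
  qed auto
  obtain x where x: "0 < x" "x < 1" "0 < radial_mass N f x"
    using assms(4) by auto
  \<comment> \<open>The point of positive mass in the logarithmic variable; \<open>x < 1\<close>
    makes it positive. Continuity then spreads positivity to a closed interval around it.\<close>
  define t where "t = - ln x"
  have t: "0 < t" "0 < ?m t"
    using x by (auto simp: t_def)
  have "open ({0<..} \<inter> ?m -` {0<..})"
    using cont by (intro continuous_open_preimage) auto
  then obtain e where e: "0 < e" "cball t e \<subseteq> {0<..} \<inter> ?m -` {0<..}"
    using t open_contains_cball by (metis IntI greaterThan_iff vimageI)
  then have sub: "{t - e..t + e} \<subseteq> {0<..} \<inter> ?m -` {0<..}"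
    by (simp add: cball_eq_atLeastAtMost)
  have "t - e \<in> {t - e..t + e}"
    using e(1) by simp
  then have "0 < t - e"
    using sub by (meson IntD1 greaterThan_iff subsetD)
  have "\<exists>L. \<forall>l\<ge>L. \<nexists>w. continuous_on {0..} w \<and> distributional_equation N f l w"
  proof (rule no_local_solution)
    show "2 \<le> N" "t - e < t + e"
      using assms(1) e(1) by auto
    show "0 < t - e" by fact
    show "continuous_on {t - e..t + e} ?m"
      using cont by (rule continuous_on_subset) (use sub in auto)
    show "0 < ?m s" if "s \<in> {t - e..t + e}" for s
      using sub that by auto
  qed
  then show ?thesis
    unfolding dirichlet_weak_solution_def navier_weak_solution_def by blast
qed

end
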